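(* Let $\mathbb{P}=(G,M,I,\prec)$ be any preferential context and let $\mathrel{|\!\sim}_{\mathbb{P}}$ be the relation it induces on the set $\mathcal{L}(M)$ of compound attributes. Then $\mathrel{|\!\sim}_{\mathbb{P}}$ is a preferential consequence relation, i.e. for all $\phi,\psi,\gamma\in\mathcal{L}(M)$, writing $\mathrel{|\!\sim}$ for $\mathrel{|\!\sim}_{\mathbb{P}}$: (REF) $\phi\mathrel{|\!\sim}\phi$; (LLE) if $\phi\equiv\psi$ and $\psi\mathrel{|\!\sim}\gamma$, then $\phi\mathrel{|\!\sim}\gamma$; (RW) if $\psi\rightarrow\gamma$ and $\phi\mathrel{|\!\sim}\psi$, then $\phi\mathrel{|\!\sim}\gamma$; (AND) if $\phi\mathrel{|\!\sim}\psi$ and $\phi\mathrel{|\!\sim}\gamma$, then $\phi\mathrel{|\!\sim}\psi\land\gamma$; (OR) if $\phi\mathrel{|\!\sim}\gamma$ and $\psi\mathrel{|\!\sim}\gamma$, then $\phi\lor\psi\mathrel{|\!\sim}\gamma$; (CUT) if $\phi\land\psi\mathrel{|\!\sim}\gamma$ and $\phi\mathrel{|\!\sim}\psi$, then $\phi\mathrel{|\!\sim}\gamma$; (CM) if $\phi\mathrel{|\!\sim}\psi$ and $\phi\mathrel{|\!\sim}\gamma$, then $\phi\land\psi\mathrel{|\!\sim}\gamma$.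
   Context: A formal context is a triple $(G,M,I)$ with $G$ a set of objects, $M$ a set of attributes and $I\subseteq G\times M$. The language $\mathcal{L}(M)$ of compound attributes is generated from the attributes $m\in M$ by $\neg,\land,\lor$. The extent $\phi^\downarrow\subseteq G$ of $\phi\in\mathcal{L}(M)$ is defined recursively: $m^\downarrow=\{g\in G\mid (g,m)\in I\}$, $(\neg\phi)^\downarrow=G\setminus\phi^\downarrow$, $(\phi\land\psi)^\downarrow=\phi^\downarrow\cap\psi^\downarrow$, $(\phi\lor\psi)^\downarrow=\phi^\downarrow\cup\psi^\downarrow$; $g\Vdash\phi$ means $g\in\phi^\downarrow$. In a given context, $\phi\rightarrow\psi$ holds iff $\phi^\downarrow\subseteq\psi^\downarrow$, and $\phi\equiv\psi$ iff $\phi^\downarrow=\psi^\downarrow$. A preferential context is $\mathbb{P}=(G,M,I,\prec)$ where $(G,M,I)$ is a formal context and $\prec$ is a strict partial order on $G$. For $B\subseteq G$ let $\underline{B}=\{g\in B\mid \nexists h\in B,\ h\prec g\}$ be the set of $\prec$-minimal elements of $B$. $\mathbb{P}$ satisfies the defeasible conditional $\phi\mathrel{|\!\sim}\psi$ iff $\underline{\phi^\downarrow}\subseteq\psi^\downarrow$. The induced relation is defined by: $\phi\mathrel{|\!\sim}_{\mathbb{P}}\psi$ iff $\mathbb{P}$ satisfies $\phi\mathrel{|\!\sim}\psi$.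
   Formalization: (CM) fails in some infinite contexts, so it is proved only under smoothness: each object in the extent of a compound attribute is minimal there or has a minimal object of that extent below it (true if G is finite); the other six rules are proved for every preferential context. *)

theory Defs
  imports Main
begin

datatype (atoms: 'm) compound =
    Attr 'm
  | Neg "'m compound"
  | And "'m compound" "'m compound"
  | Or "'m compound" "'m compound"

definition language :: "'m set \<Rightarrow> 'm compound set" where
  "language M = {\<phi>. atoms \<phi> \<subseteq> M}"

definition formal_context :: "'g set \<Rightarrow> 'm set \<Rightarrow> ('g \<times> 'm) set \<Rightarrow> bool" where
  "formal_context G M I \<longleftrightarrow> I \<subseteq> G \<times> M"

primrec extent :: "'g set \<Rightarrow> ('g \<times> 'm) set \<Rightarrow> 'm compound \<Rightarrow> 'g set" where
  "extent G I (Attr m) = {g \<in> G. (g, m) \<in> I}"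
| "extent G I (Neg \<phi>) = G - extent G I \<phi>"
| "extent G I (And \<phi> \<psi>) = extent G I \<phi> \<inter> extent G I \<psi>"
| "extent G I (Or \<phi> \<psi>) = extent G I \<phi> \<union> extent G I \<psi>"

definition holds_imp :: "'g set \<Rightarrow> ('g \<times> 'm) set \<Rightarrow> 'm compound \<Rightarrow> 'm compound \<Rightarrow> bool" where
  "holds_imp G I \<phi> \<psi> \<longleftrightarrow> extent G I \<phi> \<subseteq> extent G I \<psi>"

definition holds_equiv :: "'g set \<Rightarrow> ('g \<times> 'm) set \<Rightarrow> 'm compound \<Rightarrow> 'm compound \<Rightarrow> bool" where
  "holds_equiv G I \<phi> \<psi> \<longleftrightarrow> extent G I \<phi> = extent G I \<psi>"

(* The order is only constrained, and only ever inspected, on G. *)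
definition preferential_context ::
    "'g set \<Rightarrow> 'm set \<Rightarrow> ('g \<times> 'm) set \<Rightarrow> ('g \<Rightarrow> 'g \<Rightarrow> bool) \<Rightarrow> bool" where
  "preferential_context G M I prec \<longleftrightarrow>
     formal_context G M I \<and> irreflp_on G prec \<and> transp_on G prec"

definition minimals :: "('g \<Rightarrow> 'g \<Rightarrow> bool) \<Rightarrow> 'g set \<Rightarrow> 'g set" where
  "minimals prec B = {g \<in> B. \<not> (\<exists>h\<in>B. prec h g)}"

definition pref_entails ::
    "'g set \<Rightarrow> ('g \<times> 'm) set \<Rightarrow> ('g \<Rightarrow> 'g \<Rightarrow> bool) \<Rightarrow> 'm compound \<Rightarrow> 'm compound \<Rightarrow> bool" where
  "pref_entails G I prec \<phi> \<psi> \<longleftrightarrow> minimals prec (extent G I \<phi>) \<subseteq> extent G I \<psi>"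

definition rule_REF :: "'m set \<Rightarrow> ('m compound \<Rightarrow> 'm compound \<Rightarrow> bool) \<Rightarrow> bool" where
  "rule_REF M R \<longleftrightarrow> (\<forall>\<phi>\<in>language M. R \<phi> \<phi>)"

definition rule_LLE ::
    "'g set \<Rightarrow> 'm set \<Rightarrow> ('g \<times> 'm) set \<Rightarrow> ('m compound \<Rightarrow> 'm compound \<Rightarrow> bool) \<Rightarrow> bool" where
  "rule_LLE G M I R \<longleftrightarrow> (\<forall>\<phi>\<in>language M. \<forall>\<psi>\<in>language M. \<forall>\<gamma>\<in>language M.
     holds_equiv G I \<phi> \<psi> \<and> R \<psi> \<gamma> \<longrightarrow> R \<phi> \<gamma>)"

definition rule_RW ::
    "'g set \<Rightarrow> 'm set \<Rightarrow> ('g \<times> 'm) set \<Rightarrow> ('m compound \<Rightarrow> 'm compound \<Rightarrow> bool) \<Rightarrow> bool" where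
  "rule_RW G M I R \<longleftrightarrow> (\<forall>\<phi>\<in>language M. \<forall>\<psi>\<in>language M. \<forall>\<gamma>\<in>language M.
     holds_imp G I \<psi> \<gamma> \<and> R \<phi> \<psi> \<longrightarrow> R \<phi> \<gamma>)"

definition rule_AND :: "'m set \<Rightarrow> ('m compound \<Rightarrow> 'm compound \<Rightarrow> bool) \<Rightarrow> bool" where
  "rule_AND M R \<longleftrightarrow> (\<forall>\<phi>\<in>language M. \<forall>\<psi>\<in>language M. \<forall>\<gamma>\<in>language M.
     R \<phi> \<psi> \<and> R \<phi> \<gamma> \<longrightarrow> R \<phi> (And \<psi> \<gamma>))"

definition rule_OR :: "'m set \<Rightarrow> ('m compound \<Rightarrow> 'm compound \<Rightarrow> bool) \<Rightarrow> bool" where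
  "rule_OR M R \<longleftrightarrow> (\<forall>\<phi>\<in>language M. \<forall>\<psi>\<in>language M. \<forall>\<gamma>\<in>language M.
     R \<phi> \<gamma> \<and> R \<psi> \<gamma> \<longrightarrow> R (Or \<phi> \<psi>) \<gamma>)"

definition rule_CUT :: "'m set \<Rightarrow> ('m compound \<Rightarrow> 'm compound \<Rightarrow> bool) \<Rightarrow> bool" where
  "rule_CUT M R \<longleftrightarrow> (\<forall>\<phi>\<in>language M. \<forall>\<psi>\<in>language M. \<forall>\<gamma>\<in>language M.
     R (And \<phi> \<psi>) \<gamma> \<and> R \<phi> \<psi> \<longrightarrow> R \<phi> \<gamma>)"

definition rule_CM :: "'m set \<Rightarrow> ('m compound \<Rightarrow> 'm compound \<Rightarrow> bool) \<Rightarrow> bool" where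
  "rule_CM M R \<longleftrightarrow> (\<forall>\<phi>\<in>language M. \<forall>\<psi>\<in>language M. \<forall>\<gamma>\<in>language M.
     R \<phi> \<psi> \<and> R \<phi> \<gamma> \<longrightarrow> R (And \<phi> \<psi>) \<gamma>)"

definition preferential_consequence_relation ::
    "'g set \<Rightarrow> 'm set \<Rightarrow> ('g \<times> 'm) set \<Rightarrow> ('m compound \<Rightarrow> 'm compound \<Rightarrow> bool) \<Rightarrow> bool" where
  "preferential_consequence_relation G M I R \<longleftrightarrow>
     rule_REF M R \<and> rule_LLE G M I R \<and> rule_RW G M I R \<and> rule_AND M R \<and>
     rule_OR M R \<and> rule_CUT M R \<and> rule_CM M R"

(* The smoothness condition of Kraus, Lehmann and Magidor: an object of an extent that is
   not minimal there lies above one that is.  Every finite context is smooth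
   (finite_imp_smooth); in an infinite one that is not, CM can fail (CM_needs_smooth). *)
definition smooth ::
    "'g set \<Rightarrow> 'm set \<Rightarrow> ('g \<times> 'm) set \<Rightarrow> ('g \<Rightarrow> 'g \<Rightarrow> bool) \<Rightarrow> bool" where
  "smooth G M I prec \<longleftrightarrow> (\<forall>\<phi>\<in>language M. \<forall>g\<in>extent G I \<phi>.
     g \<in> minimals prec (extent G I \<phi>) \<or> (\<exists>h\<in>minimals prec (extent G I \<phi>). prec h g))"

lemma extent_subset: "extent G I \<phi> \<subseteq> G"
  by (induction \<phi>) auto

lemma finite_imp_smooth:
  assumes ctxt: "preferential_context G M I prec" and fin: "finite G"
  shows "smooth G M I prec"
  unfolding smooth_def
proof (intro ballI)
  fix \<phi> g assume g: "g \<in> extent G I \<phi>"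
  let ?B = "extent G I \<phi>"
  have B: "?B \<subseteq> G" by (rule extent_subset)
  have tr: "transp_on ?B prec" and ir: "irreflp_on ?B prec"
    using ctxt B unfolding preferential_context_def
    by (meson transp_on_subset irreflp_on_subset)+
  have as: "asymp_on ?B prec"
    by (intro asymp_onI notI) (meson irreflp_onD[OF ir] transp_onD[OF tr])
  obtain h where h: "h \<in> ?B" "h = g \<or> prec h g"
      and min: "\<forall>k\<in>?B. prec k h \<longrightarrow> \<not> (k = g \<or> prec k g)"
    using Finite_Set.bex_min_element_with_property[OF finite_subset[OF B fin] as tr,
        of "\<lambda>k. k = g \<or> prec k g"] g by blast
  have "h \<in> minimals prec ?B"
    unfolding minimals_def
  proof (intro CollectI conjI notI)
    show "h \<in> ?B" by (rule h)
    assume "\<exists>k\<in>?B. prec k h"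
    then obtain k where k: "k \<in> ?B" "prec k h" by blast
    then have "k = g \<or> prec k g"
      using h(2) transp_onD[OF tr k(1) h(1) g k(2)] by blast
    then show False using min k by blast
  qed
  then show "g \<in> minimals prec ?B \<or> (\<exists>h\<in>minimals prec ?B. prec h g)"
    using h by blast
qed

(* A descending chain below 0, with 0 the only object having the only attribute. *)
lemma CM_needs_smooth:
  "\<exists>(G::nat set) (M::unit set) I prec. preferential_context G M I prec \<and>
     \<not> rule_CM M (pref_entails G I prec)"
proof (intro exI conjI notI)
  let ?G = "UNIV :: nat set" and ?M = "UNIV :: unit set"
  let ?I = "{(0::nat, ())}" and ?prec = "\<lambda>h g :: nat. g < h"
  let ?m = "Attr ()" and ?top = "Or (Attr ()) (Neg (Attr ()))"
  show "preferential_context ?G ?M ?I ?prec"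
    by (simp add: preferential_context_def formal_context_def irreflp_on_def transp_on_def)
  assume cm: "rule_CM ?M (pref_entails ?G ?I ?prec)"
  have "extent ?G ?I ?top = UNIV"
    by auto
  moreover have "minimals ?prec UNIV = {}"
    unfolding minimals_def using lessI by blast
  ultimately have top: "pref_entails ?G ?I ?prec ?top \<psi>" for \<psi>
    unfolding pref_entails_def by (metis empty_subsetI)
  have lang: "\<phi> \<in> language ?M" for \<phi>
    by (simp add: language_def)
  have "pref_entails ?G ?I ?prec (And ?top ?m) (Neg ?m)"
    using cm top lang unfolding rule_CM_def by metis
  moreover have "extent ?G ?I (And ?top ?m) = {0}" "extent ?G ?I (Neg ?m) = UNIV - {0}"
    by auto
  moreover have "0 \<in> minimals ?prec {0}"
    by (simp add: minimals_def)
  ultimately show False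
    unfolding pref_entails_def by (metis DiffD2 singletonI subsetD)
qed

end

theory Submission
  imports Defs
begin

text \<open>Each rule compares minimal elements of related extents. Passing to a subset only removes
  competitors, so a minimal element stays minimal in any subset that contains it. This gives OR
  (\<open>minimals_Un_subset\<close>) and CUT (\<open>minimals_subset_minimals_Int\<close>); REF,
  LLE, RW and AND are plain set inclusions. CM needs the opposite direction: an element minimal in
  an intersection must be minimal in the larger set. An infinite descent can break this, as
  \<open>CM_needs_smooth\<close> shows, so the full list of rules is claimed under
  \<open>smooth\<close>, through \<open>minimals_Int_subset_minimals\<close>.\<close>

lemma minimals_subset: "minimals prec B \<subseteq> B"
  by (auto simp: minimals_def)

lemma minimals_Un_subset: "minimals prec (A \<union> B) \<subseteq> minimals prec A \<union> minimals prec B"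
  by (auto simp: minimals_def)

lemma minimals_subset_minimals_Int:
  assumes "minimals prec A \<subseteq> B"
  shows "minimals prec A \<subseteq> minimals prec (A \<inter> B)"
proof
  fix g assume "g \<in> minimals prec A"
  moreover from this have "g \<in> B"
    using assms ..
  ultimately show "g \<in> minimals prec (A \<inter> B)"
    by (simp add: minimals_def)
qed

text \<open>If g were not minimal in A, the second assumption would put some minimal h of A below
  it. The first assumption places h in B, so h would already defeat g inside the
  intersection.\<close>

lemma minimals_Int_subset_minimals:
  assumes "minimals prec A \<subseteq> B"
    and "\<And>g. g \<in> A \<Longrightarrow> g \<in> minimals prec A \<or> (\<exists>h\<in>minimals prec A. prec h g)"
  shows "minimals prec (A \<inter> B) \<subseteq> minimals prec A"
proof
  fix g assume g: "g \<in> minimals prec (A \<inter> B)"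
  have "\<not> prec h g" if "h \<in> minimals prec A" for h
  proof -
    have "h \<in> A \<inter> B"
      using that subsetD[OF assms(1) that] by (simp add: minimals_def)
    then show ?thesis
      using g by (simp add: minimals_def)
  qed
  moreover have "g \<in> A"
    using g by (simp add: minimals_def)
  ultimately show "g \<in> minimals prec A"
    using assms(2)[of g] by metis
qed

lemma pref_entails_REF: "rule_REF M (pref_entails G I prec)"
  by (simp add: rule_REF_def pref_entails_def minimals_subset)

lemma pref_entails_LLE: "rule_LLE G M I (pref_entails G I prec)"
  by (simp add: rule_LLE_def pref_entails_def holds_equiv_def)

lemma pref_entails_RW: "rule_RW G M I (pref_entails G I prec)"
  unfolding rule_RW_def pref_entails_def holds_imp_def
  by (intro ballI impI) (elim conjE, rule order_trans)

lemma pref_entails_AND: "rule_AND M (pref_entails G I prec)"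
  by (simp add: rule_AND_def pref_entails_def)

lemma pref_entails_OR: "rule_OR M (pref_entails G I prec)"
  unfolding rule_OR_def pref_entails_def extent.simps
  by (intro ballI impI order_trans[OF minimals_Un_subset] Un_least) simp_all

text \<open>The premise from \<phi> to \<psi> keeps the minimal objects of \<phi> inside \<psi>, so
  they are minimal for the conjunction and the other premise applies to them.\<close>

lemma pref_entails_CUT: "rule_CUT M (pref_entails G I prec)"
  unfolding rule_CUT_def pref_entails_def extent.simps
  by (intro ballI impI) (elim conjE, rule order_trans[OF minimals_subset_minimals_Int])

lemma pref_entails_CM:
  assumes "smooth G M I prec"
  shows "rule_CM M (pref_entails G I prec)"
  unfolding rule_CM_def pref_entails_def extent.simps
proof (intro ballI impI)
  fix \<phi> \<psi> \<gamma>
  assume \<phi>: "\<phi> \<in> language M"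
    and entails: "minimals prec (extent G I \<phi>) \<subseteq> extent G I \<psi> \<and>
      minimals prec (extent G I \<phi>) \<subseteq> extent G I \<gamma>"
  \<comment> \<open>Adding \<psi> creates no new minimal objects, so the premise on \<gamma> carries
    over. Smoothness is applied to the extent of \<phi>.\<close>
  have "minimals prec (extent G I \<phi> \<inter> extent G I \<psi>) \<subseteq> minimals prec (extent G I \<phi>)"
  proof (rule minimals_Int_subset_minimals)
    show "minimals prec (extent G I \<phi>) \<subseteq> extent G I \<psi>"
      using entails ..
    show "g \<in> minimals prec (extent G I \<phi>) \<or> (\<exists>h\<in>minimals prec (extent G I \<phi>). prec h g)"
      if "g \<in> extent G I \<phi>" for g
      using assms[unfolded smooth_def, rule_format, OF \<phi> that] .
  qed
  then show "minimals prec (extent G I \<phi> \<inter> extent G I \<psi>) \<subseteq> extent G I \<gamma>"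
    using entails by blast
qed

theorem theorem3:
  fixes G :: "'g set" and M :: "'m set" and I :: "('g \<times> 'm) set"
    and prec :: "'g \<Rightarrow> 'g \<Rightarrow> bool"
  assumes "preferential_context G M I prec"
  shows "rule_REF M (pref_entails G I prec) \<and>
         rule_LLE G M I (pref_entails G I prec) \<and>
         rule_RW G M I (pref_entails G I prec) \<and>
         rule_AND M (pref_entails G I prec) \<and>
         rule_OR M (pref_entails G I prec) \<and>
         rule_CUT M (pref_entails G I prec) \<and>
         (smooth G M I prec \<longrightarrow>
            preferential_consequence_relation G M I (pref_entails G I prec))"
  by (simp add: preferential_consequence_relation_def pref_entails_REF pref_entails_LLE
      pref_entails_RW pref_entails_AND pref_entails_OR pref_entails_CUT pref_entails_CM)

end
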